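(* 1. For any semigroup $S$ and any function $l : S\rightarrow\mathbb{N}$ satisfying the $(D)$ condition, there is an embedding of $S$ into a $2$-generated semigroup $H$ with generating set $\mathcal{B}=\{b_1,b_2\}$ such that the function $g\mapsto |g|_{\mathcal{B}}$ on $S$ is equivalent to the function $l$. 2. For any semigroup $S$ and any function $l : S\rightarrow\mathbb{N}$ satisfying the $(D)$ condition, there is an embedding of $S$ into a finitely generated semigroup $K$ with finite generating set $\mathcal{C}$ such that the function $g\mapsto |g|_{\mathcal{C}}$ on $S$ is equal to the function $l$.
   Context: Semigroups are not assumed to have an identity element. $\mathbb{N}=\{1,2,3,\dots\}$. For a semigroup $H$ with finite generating set $\mathcal{B}$ and $g\in H$, $|g|_{\mathcal{B}}$ denotes the number of letters in a shortest (nonempty) word over the alphabet $\mathcal{B}$ representing $g$. An embedding is an injective semigroup homomorphism; $S$ is identified with its image. A function $l:S\to\mathbb{N}$ satisfies the $(D)$ condition if both of the following hold: (D1) $l(gh)\leq l(g)+l(h)$ for all $g,h\in S$; (D2) there exists a positive number $a$ such that $\mathrm{card}\{g\in S : l(g)\leq r\}\leq a^r$ for any $r\in\mathbb{N}$. Two functions $l_1,l_2:S\to\mathbb{N}$ are equivalent, $l_1\approx l_2$, if there exist constants $c_1,c_2>0$ such that $c_1l_1(g)\leq l_2(g)\leq c_2l_1(g)$ for all $g\in S$. *)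

theory Defs
  imports Complex_Main
begin

text \<open>
  A semigroup is given by an explicit carrier and an operation, which is constrained only on the
  carrier.  The class \<open>semigroup_mult\<close> and the locale \<open>semigroup\<close> of HOL take a whole type as
  carrier, and HOL has no existential quantifier over types.  Finitely generated semigroups are
  countable, hence up to isomorphism their carriers can be taken to be sets of natural numbers.
\<close>

locale semigroup_on =
  fixes S :: "'a set" and mult :: "'a \<Rightarrow> 'a \<Rightarrow> 'a"
  assumes closed: "\<And>x y. x \<in> S \<Longrightarrow> y \<in> S \<Longrightarrow> mult x y \<in> S"
    and assoc: "\<And>x y z. x \<in> S \<Longrightarrow> y \<in> S \<Longrightarrow> z \<in> S \<Longrightarrow> mult (mult x y) z = mult x (mult y z)"

definition semigroup_embedding ::
    "'a set \<Rightarrow> ('a \<Rightarrow> 'a \<Rightarrow> 'a) \<Rightarrow> 'b set \<Rightarrow> ('b \<Rightarrow> 'b \<Rightarrow> 'b) \<Rightarrow> ('a \<Rightarrow> 'b) \<Rightarrow> bool" where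
  "semigroup_embedding S f H g \<phi> \<longleftrightarrow>
     \<phi> ` S \<subseteq> H \<and> inj_on \<phi> S \<and> (\<forall>x\<in>S. \<forall>y\<in>S. \<phi> (f x y) = g (\<phi> x) (\<phi> y))"

text \<open>
  There is no identity element, so only nonempty words represent elements.
\<close>

definition word_value :: "('a \<Rightarrow> 'a \<Rightarrow> 'a) \<Rightarrow> 'a list \<Rightarrow> 'a" where
  "word_value f w = foldl f (hd w) (tl w)"

definition represents :: "('a \<Rightarrow> 'a \<Rightarrow> 'a) \<Rightarrow> 'a set \<Rightarrow> 'a list \<Rightarrow> 'a \<Rightarrow> bool" where
  "represents f B w x \<longleftrightarrow> w \<noteq> [] \<and> set w \<subseteq> B \<and> word_value f w = x"

definition generates :: "'a set \<Rightarrow> ('a \<Rightarrow> 'a \<Rightarrow> 'a) \<Rightarrow> 'a set \<Rightarrow> bool" where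
  "generates H f B \<longleftrightarrow> B \<subseteq> H \<and> (\<forall>x\<in>H. \<exists>w. represents f B w x)"

definition word_length :: "('a \<Rightarrow> 'a \<Rightarrow> 'a) \<Rightarrow> 'a set \<Rightarrow> 'a \<Rightarrow> nat" where
  "word_length f B x = (LEAST n. \<exists>w. represents f B w x \<and> length w = n)"

text \<open>
  The values of \<open>l\<close> and the radii \<open>r\<close> range over the positive integers.  Finiteness of the balls is
  stated separately because \<open>card\<close> is 0 on infinite sets.
\<close>

definition D_condition :: "'a set \<Rightarrow> ('a \<Rightarrow> 'a \<Rightarrow> 'a) \<Rightarrow> ('a \<Rightarrow> nat) \<Rightarrow> bool" where
  "D_condition S f l \<longleftrightarrow>
     (\<forall>x\<in>S. 1 \<le> l x) \<and>
     (\<forall>x\<in>S. \<forall>y\<in>S. l (f x y) \<le> l x + l y) \<and>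
     (\<exists>a::real. 0 < a \<and>
        (\<forall>r\<ge>1. finite {x\<in>S. l x \<le> r} \<and> real (card {x\<in>S. l x \<le> r}) \<le> a ^ r))"

definition equivalent_on :: "'a set \<Rightarrow> ('a \<Rightarrow> nat) \<Rightarrow> ('a \<Rightarrow> nat) \<Rightarrow> bool" where
  "equivalent_on S l1 l2 \<longleftrightarrow>
     (\<exists>c1 c2 :: real. 0 < c1 \<and> 0 < c2 \<and>
        (\<forall>x\<in>S. c1 * real (l1 x) \<le> real (l2 x) \<and> real (l2 x) \<le> c2 * real (l1 x)))"

end

theory Submission
  imports Defs "HOL-Library.Countable"
begin

text \<open>
  Code the elements of \<open>S\<close> by words \<open>w g\<close> over a finite alphabet so that \<open>w g\<close> has length
  (comparable to) \<open>l g\<close>, which the growth condition (D2) makes possible, and so that a codeword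
  occurring in a product of codewords is always one of the factors.  Take the free semigroup modulo
  the syntactic congruence of the partial map sending \<open>w g\<^sub>1 \<dots> w g\<^sub>k\<close> to
  \<open>g\<^sub>1 \<dots> g\<^sub>k\<close>.  Then \<open>w g w h\<close> and \<open>w (g h)\<close> are congruent, and a word
  congruent to \<open>w g\<close> is a product \<open>w g\<^sub>1 \<dots> w g\<^sub>k\<close> with \<open>g\<^sub>1 \<dots> g\<^sub>k = g\<close>, so
  by (D1) it is not shorter than \<open>l g\<close>.
\<close>

section \<open>Semigroups from codes\<close>

lemma word_value_Cons: "word_value f (x # xs) = foldl f x xs"
  by (simp add: word_value_def)

lemma word_value_snoc: "xs \<noteq> [] \<Longrightarrow> word_value f (xs @ [x]) = f (word_value f xs) x"
  by (cases xs) (simp_all add: word_value_Cons)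

context semigroup_on
begin

lemma foldl_closed: "a \<in> S \<Longrightarrow> set xs \<subseteq> S \<Longrightarrow> foldl mult a xs \<in> S"
  by (induction xs arbitrary: a) (auto simp: closed)

text \<open>Associativity is applied once, to the value of \<open>xs\<close>, \<open>g\<close> and
  \<open>h\<close>; after that both left folds run over \<open>ys\<close> from the same
  element.\<close>

lemma word_value_contract:
  assumes "set xs \<subseteq> S" "g \<in> S" "h \<in> S"
  shows "word_value mult (xs @ g # h # ys) = word_value mult (xs @ mult g h # ys)"
proof (cases xs)
  case (Cons a as)
  then have "foldl mult a as \<in> S" using assms by (auto intro: foldl_closed)
  then show ?thesis using Cons assms by (simp add: word_value_Cons assoc)
qed (simp add: word_value_Cons)

lemma subadditive_word_value:
  fixes l :: "'a \<Rightarrow> nat"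
  assumes sub: "\<And>x y. x \<in> S \<Longrightarrow> y \<in> S \<Longrightarrow> l (mult x y) \<le> l x + l y"
    and "xs \<noteq> []" "set xs \<subseteq> S"
  shows "l (word_value mult xs) \<le> sum_list (map l xs)"
proof -
  have "l (foldl mult a as) \<le> l a + sum_list (map l as)" if "a \<in> S" "set as \<subseteq> S" for a as
    using that
  proof (induction as arbitrary: a)
    case (Cons b as)
    have "l (foldl mult (mult a b) as) \<le> l (mult a b) + sum_list (map l as)"
      using Cons by (auto simp: closed)
    also have "l (mult a b) \<le> l a + l b" using Cons.prems sub by auto
    finally show ?case by simp
  qed simp
  then show ?thesis using assms(2,3) by (cases xs) (auto simp: word_value_Cons)
qed

end

text \<open>The letters are countable so that words, and hence their classes, can be numbered. The
  continuations \<open>y\<close> and \<open>v\<close> are arbitrary: \<open>prefix_free\<close> thus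
  contains injectivity of \<open>w\<close>, and \<open>no_interior_start\<close> also excludes
  overlaps that run past the end of \<open>w h\<close>.\<close>

locale coded_semigroup = semigroup_on S f for S :: "'a set" and f +
  fixes C :: "'c::countable set" and w :: "'a \<Rightarrow> 'c list"
  assumes code_nonempty: "g \<in> S \<Longrightarrow> w g \<noteq> []"
    and code_letters: "g \<in> S \<Longrightarrow> set (w g) \<subseteq> C"
    and prefix_free: "g \<in> S \<Longrightarrow> h \<in> S \<Longrightarrow> w g @ y = w h @ v \<Longrightarrow> g = h"
    and no_interior_start:
      "g \<in> S \<Longrightarrow> h \<in> S \<Longrightarrow> x @ w g @ y = w h @ v \<Longrightarrow> x = [] \<or> length (w h) \<le> length x"
begin

text \<open>An occurrence at the very start is the first factor by \<open>prefix_free\<close>. Any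
  other one begins after the first factor by \<open>no_interior_start\<close>, so that factor can be
  stripped off.\<close>

lemma codeword_is_factor:
  assumes "concat (map w gs) = x @ w g @ y" "set gs \<subseteq> S" "g \<in> S"
  shows "\<exists>as bs. gs = as @ g # bs \<and> x = concat (map w as) \<and> y = concat (map w bs)"
  using assms
proof (induction gs arbitrary: x)
  case Nil
  then show ?case using code_nonempty by simp
next
  case (Cons h gs)
  have eq: "x @ w g @ y = w h @ concat (map w gs)" using Cons.prems by simp
  show ?case
  proof (cases "x = []")
    case True
    then have "g = h" using eq prefix_free[of g h] Cons.prems by auto
    then show ?thesis using True eq by (intro exI[of _ "[]"] exI[of _ gs]) simp
  next
    case False
    then have "length (w h) \<le> length x" using eq no_interior_start[of g h] Cons.prems by auto
    then obtain x' where x': "x = w h @ x'"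
      using eq by (metis append_eq_append_conv_if append_take_drop_id)
    then have "concat (map w gs) = x' @ w g @ y" using eq by simp
    then obtain as bs where "gs = as @ g # bs" "x' = concat (map w as)" "y = concat (map w bs)"
      using Cons by auto
    then show ?thesis using x' by (intro exI[of _ "h # as"] exI[of _ bs]) simp
  qed
qed

section \<open>The partial evaluation of words\<close>

lemma concat_code_eq_Nil: "set gs \<subseteq> S \<Longrightarrow> concat (map w gs) = [] \<longleftrightarrow> gs = []"
  using code_nonempty by (cases gs) auto

definition decodes :: "'c list \<Rightarrow> 'a \<Rightarrow> bool" where
  "decodes u g \<longleftrightarrow>
     (\<exists>gs. gs \<noteq> [] \<and> set gs \<subseteq> S \<and> u = concat (map w gs) \<and> word_value f gs = g)"

lemma decodes_code: "g \<in> S \<Longrightarrow> decodes (w g) g"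
  unfolding decodes_def by (rule exI[of _ "[g]"]) (simp add: word_value_Cons)

text \<open>The word \<open>w h\<close> is a factor of the product it equals, and what remains on
  either side is empty, so \<open>h\<close> is the only factor.\<close>

lemma decodes_code_unique:
  assumes "decodes (w h) g" "h \<in> S"
  shows "g = h"
proof -
  obtain gs where gs: "set gs \<subseteq> S" "concat (map w gs) = [] @ w h @ []" "word_value f gs = g"
    using assms(1) unfolding decodes_def by auto
  obtain as bs where ab: "gs = as @ h # bs" "[] = concat (map w as)" "[] = concat (map w bs)"
    using codeword_is_factor[OF gs(2,1) assms(2)] by blast
  moreover have "set as \<subseteq> S" "set bs \<subseteq> S" using gs(1) ab(1) by auto
  ultimately have "as = []" "bs = []" using concat_code_eq_Nil by auto
  then show ?thesis using ab gs(3) by (simp add: word_value_Cons)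
qed

text \<open>In any decoding the displayed codewords are factors, and exchanging \<open>g\<close>,
  \<open>h\<close> for \<open>f g h\<close> keeps the value.\<close>

lemma decodes_mult:
  assumes "g \<in> S" "h \<in> S"
  shows "decodes (x @ (w g @ w h) @ y) k \<longleftrightarrow> decodes (x @ w (f g h) @ y) k"
proof
  assume "decodes (x @ (w g @ w h) @ y) k"
  then obtain gs where gs: "set gs \<subseteq> S" "concat (map w gs) = x @ w g @ (w h @ y)" "word_value f gs = k"
    unfolding decodes_def by auto
  obtain as bs where ab: "gs = as @ g # bs" "x = concat (map w as)" "w h @ y = concat (map w bs)"
    using codeword_is_factor[OF gs(2,1) assms(1)] by blast
  \<comment> \<open>The factor lemma applies again to what follows \<open>g\<close>; the empty left
    context forces \<open>as'\<close> to be empty, so \<open>h\<close> comes directly after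
    \<open>g\<close>.\<close>
  then have "concat (map w bs) = [] @ w h @ y" "set bs \<subseteq> S" using gs(1) by auto
  then obtain as' bs' where ab': "bs = as' @ h # bs'" "[] = concat (map w as')" "y = concat (map w bs')"
    using codeword_is_factor[OF _ _ assms(2)] by blast
  then have "as' = []" using \<open>set bs \<subseteq> S\<close> concat_code_eq_Nil[of as'] by auto
  then have "gs = as @ g # h # bs'" using ab ab' by simp
  then show "decodes (x @ w (f g h) @ y) k"
    unfolding decodes_def using gs ab ab' assms closed
    by (intro exI[of _ "as @ f g h # bs'"]) (auto simp: word_value_contract)
next
  assume "decodes (x @ w (f g h) @ y) k"
  then obtain gs where gs: "set gs \<subseteq> S" "concat (map w gs) = x @ w (f g h) @ y" "word_value f gs = k"
    unfolding decodes_def by auto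
  obtain as bs where ab: "gs = as @ f g h # bs" "x = concat (map w as)" "y = concat (map w bs)"
    using codeword_is_factor[OF gs(2,1)] closed assms by blast
  then show "decodes (x @ (w g @ w h) @ y) k"
    unfolding decodes_def using gs assms
    by (intro exI[of _ "as @ g # h # bs"]) (auto simp: word_value_contract)
qed

section \<open>The congruence on words and its quotient\<close>

definition cong :: "'c list \<Rightarrow> 'c list \<Rightarrow> bool" where
  "cong u v \<longleftrightarrow> (\<forall>x y g. decodes (x @ u @ y) g \<longleftrightarrow> decodes (x @ v @ y) g)"

lemma cong_refl: "cong u u"
  by (simp add: cong_def)

text \<open>One factor is replaced at a time, the other being absorbed into the context.\<close>

lemma cong_append:
  assumes "cong u u'" "cong v v'"
  shows "cong (u @ v) (u' @ v')"
  unfolding cong_def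
proof (intro allI)
  fix x y g
  have "decodes (x @ u @ (v @ y)) g \<longleftrightarrow> decodes (x @ u' @ (v @ y)) g"
    using assms(1) unfolding cong_def by blast
  also have "\<dots> \<longleftrightarrow> decodes ((x @ u') @ v' @ y) g"
    using assms(2) unfolding cong_def by (metis append.assoc)
  finally show "decodes (x @ (u @ v) @ y) g \<longleftrightarrow> decodes (x @ (u' @ v') @ y) g" by simp
qed

lemma cong_decodes: "cong u v \<Longrightarrow> decodes u g \<longleftrightarrow> decodes v g"
  unfolding cong_def by (metis append_Nil append_Nil2)

text \<open>Congruence classes are represented by the number of a chosen member.\<close>

definition cls :: "'c list \<Rightarrow> nat" where
  "cls u = to_nat (SOME v. cong u v)"

definition cls_mult :: "nat \<Rightarrow> nat \<Rightarrow> nat" where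
  "cls_mult m n = cls (from_nat m @ from_nat n)"

definition cls_carrier :: "nat set" where
  "cls_carrier = cls ` {u. u \<noteq> [] \<and> set u \<subseteq> C}"

lemma cong_from_nat_cls: "cong u (from_nat (cls u))"
  using someI[of "cong u", OF cong_refl] by (simp add: cls_def)

lemma cls_eq_iff: "cls u = cls v \<longleftrightarrow> cong u v"
proof
  assume "cls u = cls v"
  then show "cong u v" using cong_from_nat_cls[of u] cong_from_nat_cls[of v] by (simp add: cong_def)
next
  assume "cong u v"
  \<comment> \<open>The two predicates are equal, so \<open>SOME\<close> picks the same member for
    both words.\<close>
  then have "cong u = cong v" by (auto simp: cong_def fun_eq_iff)
  then show "cls u = cls v" by (simp add: cls_def)
qed

lemma cls_mult_cls: "cls_mult (cls u) (cls v) = cls (u @ v)"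
proof -
  have "cong (u @ v) (from_nat (cls u) @ from_nat (cls v))"
    by (intro cong_append cong_from_nat_cls)
  then show ?thesis by (simp add: cls_mult_def flip: cls_eq_iff)
qed

lemma semigroup_cls: "semigroup_on cls_carrier cls_mult"
proof
  fix x y z assume "x \<in> cls_carrier" "y \<in> cls_carrier"
  then show "cls_mult x y \<in> cls_carrier"
    by (auto simp: cls_carrier_def cls_mult_cls)
  assume "z \<in> cls_carrier"
  then show "cls_mult (cls_mult x y) z = cls_mult x (cls_mult y z)"
    using \<open>x \<in> cls_carrier\<close> \<open>y \<in> cls_carrier\<close> by (auto simp: cls_carrier_def cls_mult_cls)
qed

section \<open>Generators, embedding and word length\<close>

definition letter :: "'c \<Rightarrow> nat" where
  "letter c = cls [c]"

lemma word_value_letters: "u \<noteq> [] \<Longrightarrow> word_value cls_mult (map letter u) = cls u"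
proof (induction u rule: rev_nonempty_induct)
  case (single x)
  then show ?case by (simp add: word_value_Cons letter_def)
next
  case (snoc x xs)
  then show ?case by (simp add: word_value_snoc letter_def cls_mult_cls)
qed

text \<open>Although \<open>letter\<close> may identify letters, every word over the generators
  lifts letter by letter to a word over \<open>C\<close> of the same length. Word length can
  therefore be studied on words over \<open>C\<close>.\<close>

lemma represents_letters:
  "represents cls_mult (letter ` C) ws x \<longleftrightarrow>
     (\<exists>u. u \<noteq> [] \<and> set u \<subseteq> C \<and> ws = map letter u \<and> cls u = x)"
proof
  assume *: "represents cls_mult (letter ` C) ws x"
  then have "ws \<in> lists (letter ` C)" by (auto simp: represents_def)
  then obtain u where "set u \<subseteq> C" "ws = map letter u" by (auto simp: lists_image)
  then show "\<exists>u. u \<noteq> [] \<and> set u \<subseteq> C \<and> ws = map letter u \<and> cls u = x"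
    using * word_value_letters by (auto simp: represents_def)
next
  assume "\<exists>u. u \<noteq> [] \<and> set u \<subseteq> C \<and> ws = map letter u \<and> cls u = x"
  then show "represents cls_mult (letter ` C) ws x"
    unfolding represents_def using word_value_letters by fastforce
qed

lemma generates_cls: "generates cls_carrier cls_mult (letter ` C)"
  unfolding generates_def represents_letters
  by (auto simp: cls_carrier_def letter_def)

lemma embedding_cls: "semigroup_embedding S f cls_carrier cls_mult (\<lambda>g. cls (w g))"
  unfolding semigroup_embedding_def
proof (intro conjI ballI inj_onI image_subsetI)
  fix g assume g: "g \<in> S"
  then show "cls (w g) \<in> cls_carrier"
    using code_nonempty code_letters by (auto simp: cls_carrier_def)
  fix h assume h: "h \<in> S"
  show "cls (w (f g h)) = cls_mult (cls (w g)) (cls (w h))"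
    using decodes_mult[OF g h] by (simp add: cls_mult_cls cls_eq_iff cong_def)
  \<comment> \<open>Congruent words have the same decodings, and \<open>w h\<close> decodes to
    \<open>h\<close> only.\<close>
  show "g = h" if "cls (w g) = cls (w h)"
    using that g h cong_decodes decodes_code decodes_code_unique unfolding cls_eq_iff by blast
qed

lemma word_length_cls:
  fixes l :: "'a \<Rightarrow> nat"
  assumes sub: "\<And>x y. x \<in> S \<Longrightarrow> y \<in> S \<Longrightarrow> l (f x y) \<le> l x + l y"
    and le: "\<And>x. x \<in> S \<Longrightarrow> l x \<le> length (w x)" and g: "g \<in> S"
  shows "l g \<le> word_length cls_mult (letter ` C) (cls (w g))"
    and "word_length cls_mult (letter ` C) (cls (w g)) \<le> length (w g)"
proof -
  let ?P = "\<lambda>n. \<exists>ws. represents cls_mult (letter ` C) ws (cls (w g)) \<and> length ws = n"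
  have P: "?P (length (w g))"
    using code_nonempty[OF g] code_letters[OF g] unfolding represents_letters
    by (intro exI[of _ "map letter (w g)"]) auto
  show "word_length cls_mult (letter ` C) (cls (w g)) \<le> length (w g)"
    unfolding word_length_def by (rule Least_le) (rule P)
  have "?P (word_length cls_mult (letter ` C) (cls (w g)))"
    unfolding word_length_def by (rule LeastI) (rule P)
  then obtain u where u: "cong u (w g)" "length u = word_length cls_mult (letter ` C) (cls (w g))"
    unfolding represents_letters cls_eq_iff by auto
  \<comment> \<open>A shortest word \<open>u\<close> is congruent to \<open>w g\<close>, hence
    decodes to \<open>g\<close> and is itself a product of codewords.\<close>
  then obtain gs where gs: "gs \<noteq> []" "set gs \<subseteq> S" "u = concat (map w gs)" "word_value f gs = g"
    using cong_decodes decodes_code[OF g] unfolding decodes_def by blast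
  have "l g \<le> sum_list (map l gs)"
    using subadditive_word_value[of l gs] sub gs by auto
  also have "\<dots> \<le> sum_list (map (length \<circ> w) gs)"
    using gs(2) le by (intro sum_list_mono) auto
  also have "\<dots> = length u" by (simp add: gs(3) length_concat)
  finally show "l g \<le> word_length cls_mult (letter ` C) (cls (w g))" using u by simp
qed

text \<open>If the letters agreed, replacing the initial \<open>c\<close> of \<open>w g\<close> by
  \<open>d\<close> would leave a decodable word, whose first factor would begin with
  \<open>d\<close>. This keeps two generators distinct.\<close>

lemma letter_neq:
  assumes g: "g \<in> S" "w g = c # u" and d: "\<And>h v. h \<in> S \<Longrightarrow> w h \<noteq> d # v"
  shows "letter c \<noteq> letter d"
proof
  assume "letter c = letter d"
  then have "decodes ([] @ [d] @ u) g"
    using decodes_code[OF g(1)] g(2) unfolding letter_def cls_eq_iff cong_def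
    by (metis append_Nil append_Cons)
  then obtain h gs where "h \<in> S" "d # u = w h @ concat (map w gs)"
    unfolding decodes_def by (auto simp: neq_Nil_conv)
  then show False using d code_nonempty by (cases "w h") auto
qed

end


section \<open>Two codes\<close>

text \<open>Each sphere of radius \<open>r\<close> has at most \<open>a ^ r\<close> elements, no
  more than there are words of length \<open>N * r\<close> over \<open>A\<close>. Spheres are coded
  separately; as \<open>N\<close> is positive, the length of a codeword reveals the sphere.\<close>

lemma exists_coding:
  fixes l :: "'a \<Rightarrow> nat" and A :: "'c set" and a :: real
  assumes pos: "\<And>x. x \<in> S \<Longrightarrow> 1 \<le> l x" and a: "0 < a"
    and ball: "\<And>r. 1 \<le> r \<Longrightarrow> finite {x \<in> S. l x \<le> r} \<and> real (card {x \<in> S. l x \<le> r}) \<le> a ^ r"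
    and A: "finite A" "a \<le> real (card A ^ N)" and N: "0 < N"
  obtains c :: "'a \<Rightarrow> 'c list"
    where "inj_on c S" "\<And>x. x \<in> S \<Longrightarrow> set (c x) \<subseteq> A" "\<And>x. x \<in> S \<Longrightarrow> length (c x) = N * l x"
proof -
  have "\<exists>c. inj_on c {x \<in> S. l x = r} \<and> c ` {x \<in> S. l x = r} \<subseteq> {xs. set xs \<subseteq> A \<and> length xs = N * r}"
    if r: "1 \<le> r" for r
  proof -
    have "card {x \<in> S. l x = r} \<le> card {x \<in> S. l x \<le> r}"
      using ball[OF r] by (intro card_mono) auto
    then have "real (card {x \<in> S. l x = r}) \<le> a ^ r" using ball[OF r] by linarith
    also have "\<dots> \<le> real (card A ^ N) ^ r" using a A(2) by (intro power_mono) auto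
    also have "\<dots> = real (card {xs. set xs \<subseteq> A \<and> length xs = N * r})"
      using A(1) by (simp add: card_lists_length_eq power_mult)
    finally have "card {x \<in> S. l x = r} \<le> card {xs. set xs \<subseteq> A \<and> length xs = N * r}" by simp
    moreover have "finite {x \<in> S. l x = r}"
      using ball[OF r] by (auto intro: rev_finite_subset)
    ultimately show ?thesis
      using card_le_inj[OF _ finite_lists_length_eq[OF A(1)]] by blast
  qed
  then have "\<exists>c. \<forall>r. 1 \<le> r \<longrightarrow> inj_on (c r) {x \<in> S. l x = r} \<and>
      c r ` {x \<in> S. l x = r} \<subseteq> {xs. set xs \<subseteq> A \<and> length xs = N * r}"
    by (intro choice) simp
  then obtain c where c: "\<And>r. 1 \<le> r \<Longrightarrow> inj_on (c r) {x \<in> S. l x = r}"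
    "\<And>r. 1 \<le> r \<Longrightarrow> c r ` {x \<in> S. l x = r} \<subseteq> {xs. set xs \<subseteq> A \<and> length xs = N * r}"
    by blast
  have mem: "c (l x) x \<in> {xs. set xs \<subseteq> A \<and> length xs = N * l x}" if "x \<in> S" for x
    using c(2)[OF pos[OF that]] that by blast
  show thesis
  proof (rule that[of "\<lambda>x. c (l x) x"])
    show "inj_on (\<lambda>x. c (l x) x) S"
    proof (rule inj_onI)
      fix x y assume xy: "x \<in> S" "y \<in> S" "c (l x) x = c (l y) y"
      then have "l x = l y" using mem[of x] mem[of y] N by auto
      then show "x = y" using xy c(1)[OF pos[OF xy(1)]] by (auto dest: inj_onD)
    qed
  qed (use mem in auto)
qed

text \<open>
  Self-delimiting, and two consecutive \<open>True\<close>s never occur, so that they can mark the start of a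
  codeword.
\<close>

fun bit_code :: "bool list \<Rightarrow> bool list" where
  "bit_code [] = [False, False]"
| "bit_code (b # bs) = False # True # False # b # bit_code bs"

lemma length_bit_code: "length (bit_code bs) = 4 * length bs + 2"
  by (induction bs) auto

text \<open>The second letter tells a further block (\<open>True\<close>) from the terminator
  (\<open>False\<close>).\<close>

lemma bit_code_prefix_free: "bit_code bs @ y = bit_code cs @ v \<Longrightarrow> bs = cs"
proof (induction bs arbitrary: cs)
  case Nil
  then show ?case by (cases cs) auto
next
  case (Cons b bs)
  then show ?case by (cases cs) auto
qed

lemma bit_code_nth_0: "(bit_code bs @ v) ! 0 = False"
  by (cases bs) auto

lemma bit_code_no_marker:
  "k < length (bit_code bs) \<Longrightarrow> \<not> ((bit_code bs @ v) ! k \<and> (bit_code bs @ v) ! Suc k)"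
proof (induction bs arbitrary: k)
  case Nil
  then show ?case by (auto simp: less_Suc_eq)
next
  case (Cons b bs)
  show ?case
  proof (cases "k < 4")
    case True
    then have "k = 0 \<or> k = 1 \<or> k = 2 \<or> k = 3" by auto
    \<comment> \<open>The data bit at position 3 may be \<open>True\<close>, but the next letter
      starts the code of \<open>bs\<close> and is \<open>False\<close>.\<close>
    then show ?thesis using bit_code_nth_0[of bs v] by (auto simp: numeral_3_eq_3)
  next
    case False
    then obtain j where "k = Suc (Suc (Suc (Suc j)))"
      by (intro that[of "k - 4"]) simp
    then show ?thesis using Cons by auto
  qed
qed

text \<open>An interior start would give two adjacent \<open>True\<close>s beginning at position 1
  or later. Position 1 is followed by the initial \<open>False\<close> of the bit code, and the
  later positions fall under \<open>bit_code_no_marker\<close>.\<close>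

lemma marked_bit_code_no_interior_start:
  assumes "x @ (True # True # bit_code bs) @ y = (True # True # bit_code cs) @ v"
  shows "x = [] \<or> length (True # True # bit_code cs) \<le> length x"
proof (rule ccontr)
  assume "\<not> ?thesis"
  then obtain k where k: "length x = Suc k" "k < Suc (length (bit_code cs))"
    by (cases x) auto
  let ?z = "(True # True # bit_code cs) @ v"
  have "?z ! length x = True" "?z ! Suc (length x) = True"
    unfolding assms[symmetric] by (simp_all add: nth_append)
  then show False
    using k bit_code_nth_0[of cs v] bit_code_no_marker[of _ cs v] by (cases k) auto
qed

text \<open>Storing the end marks inside the letters enlarges the alphabet but not the word, which
  gives equality with \<open>l\<close> and not only equivalence.\<close>

definition flag_ends :: "'c list \<Rightarrow> ('c \<times> bool \<times> bool) list" where
  "flag_ends xs = map (\<lambda>k. (xs ! k, k = 0, Suc k = length xs)) [0..<length xs]"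

lemma length_flag_ends [simp]: "length (flag_ends xs) = length xs"
  by (simp add: flag_ends_def)

lemma nth_flag_ends: "k < length xs \<Longrightarrow> flag_ends xs ! k = (xs ! k, k = 0, Suc k = length xs)"
  by (simp add: flag_ends_def)

lemma set_flag_ends: "set xs \<subseteq> A \<Longrightarrow> set (flag_ends xs) \<subseteq> A \<times> UNIV"
  by (auto simp: flag_ends_def)

text \<open>The last letter of \<open>xs\<close> carries the end flag, while a longer
  \<open>zs\<close> has an unflagged letter at that position.\<close>

lemma length_le_of_flag_ends_append_eq:
  assumes "flag_ends xs @ y = flag_ends zs @ v" "xs \<noteq> []"
  shows "length zs \<le> length xs"
proof (rule ccontr)
  assume *: "\<not> ?thesis"
  obtain k where k: "length xs = Suc k" using assms(2) by (cases xs) auto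
  have "(flag_ends xs @ y) ! k = (flag_ends zs @ v) ! k"
    using assms(1) by simp
  then show False using * k by (simp add: nth_append nth_flag_ends)
qed

lemma flag_ends_prefix_free:
  assumes "flag_ends xs @ y = flag_ends zs @ v" "xs \<noteq> []" "zs \<noteq> []"
  shows "xs = zs"
proof -
  have len: "length xs = length zs"
    using length_le_of_flag_ends_append_eq assms by (metis le_antisym)
  then have eq: "flag_ends xs = flag_ends zs" using assms(1) by simp
  show ?thesis
  proof (rule nth_equalityI[OF len])
    fix k assume "k < length xs"
    then show "xs ! k = zs ! k" using eq len nth_flag_ends by (metis fst_conv)
  qed
qed

text \<open>The first letter of \<open>xs\<close> carries the start flag, which \<open>zs\<close>
  has only at position 0.\<close>

lemma flag_ends_no_interior_start:
  assumes "x @ flag_ends xs @ y = flag_ends zs @ v" "xs \<noteq> []"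
  shows "x = [] \<or> length (flag_ends zs) \<le> length x"
proof (rule ccontr)
  assume *: "\<not> ?thesis"
  have "(x @ flag_ends xs @ y) ! length x = (flag_ends zs @ v) ! length x"
    using assms(1) by simp
  then show False using * assms(2) by (auto simp: nth_append nth_flag_ends)
qed

section \<open>The two extensions\<close>

lemma exists_two_generated_extension:
  fixes S :: "'a set" and l :: "'a \<Rightarrow> nat"
  assumes S: "semigroup_on S f" and D: "D_condition S f l"
  shows "\<exists>(H :: nat set) h b1 b2 \<phi>.
        semigroup_on H h \<and> b1 \<noteq> b2 \<and> generates H h {b1, b2} \<and>
        semigroup_embedding S f H h \<phi> \<and>
        equivalent_on S (\<lambda>g. word_length h {b1, b2} (\<phi> g)) l"
proof (cases "S = {}")
  case True
  \<comment> \<open>For empty \<open>S\<close> nothing decodes and the quotient would collapse to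
    one element; the left-zero semigroup on two elements is taken instead.\<close>
  let ?h = "\<lambda>x y :: nat. x"
  have "semigroup_on {0, 1} ?h" by unfold_locales auto
  moreover have "represents ?h {0, 1} [x] x" if "x \<in> {0, 1}" for x
    using that by (auto simp: represents_def word_value_def)
  then have "generates {0, 1} ?h {0, 1}" unfolding generates_def by blast
  moreover have "semigroup_embedding S f {0, 1} ?h (\<lambda>_. 0)"
    "equivalent_on S (\<lambda>g. word_length ?h {0, 1} 0) l"
    using True by (auto simp: semigroup_embedding_def equivalent_on_def intro: exI[of _ 1])
  ultimately show ?thesis
    by (intro exI[of _ "{0, 1}"] exI[of _ ?h] exI[of _ 0] exI[of _ 1] exI[of _ "\<lambda>_. 0"]) auto
next
  case False
  from D obtain a :: real where l: "\<And>x. x \<in> S \<Longrightarrow> 1 \<le> l x"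
    "\<And>x y. x \<in> S \<Longrightarrow> y \<in> S \<Longrightarrow> l (f x y) \<le> l x + l y"
    and a: "0 < a" "\<And>r. 1 \<le> r \<Longrightarrow> finite {x \<in> S. l x \<le> r} \<and> real (card {x \<in> S. l x \<le> r}) \<le> a ^ r"
    unfolding D_condition_def by blast
  obtain N0 where N0: "a < 2 ^ N0" using real_arch_pow[of 2 a] by auto
  \<comment> \<open>The successor makes \<open>N\<close> positive even when \<open>N0\<close> is
    0.\<close>
  define N where "N = Suc N0"
  have "(2::real) ^ N0 \<le> 2 ^ N" by (rule power_increasing) (simp_all add: N_def)
  then have "a \<le> 2 ^ N" using N0 by linarith
  then have "a \<le> real (card (UNIV :: bool set) ^ N)" by (simp add: card_UNIV_bool)
  then obtain c :: "'a \<Rightarrow> bool list" where c: "inj_on c S" "\<And>x. x \<in> S \<Longrightarrow> length (c x) = N * l x"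
    using exists_coding[of S l a "UNIV :: bool set" N] l a by (auto simp: N_def)
  define w where "w g = True # True # bit_code (c g)" for g
  interpret semigroup_on S f by (rule S)
  interpret coded_semigroup S f UNIV w
  proof
    show "w g \<noteq> []" "set (w g) \<subseteq> UNIV" for g by (auto simp: w_def)
    show "g = h" if "g \<in> S" "h \<in> S" "w g @ y = w h @ v" for g h y v
      using that bit_code_prefix_free[of "c g" y "c h" v] c(1) by (auto simp: w_def dest: inj_onD)
    show "x = [] \<or> length (w h) \<le> length x" if "x @ w g @ y = w h @ v" for g h x y v
      using that unfolding w_def by (rule marked_bit_code_no_interior_start)
  qed
  have length_w: "length (w g) = 4 * (N * l g) + 4" if "g \<in> S" for g
    using that by (simp add: w_def length_bit_code c(2))
  have lower: "l g \<le> length (w g)" if "g \<in> S" for g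
    using length_w[OF that] by (simp add: N_def)
  \<comment> \<open>The two markers and the two terminating letters add 4, which is absorbed because
    \<open>l g\<close> is at least 1.\<close>
  have upper: "length (w g) \<le> (4 * N + 4) * l g" if "g \<in> S" for g
    using length_w[OF that] l(1)[OF that] by (simp add: algebra_simps)
  have letters: "letter ` UNIV = {letter True, letter False}"
    by (auto simp: UNIV_bool)
  let ?len = "\<lambda>g. word_length cls_mult {letter True, letter False} (cls (w g))"
  have len: "l g \<le> ?len g" "?len g \<le> (4 * N + 4) * l g" if "g \<in> S" for g
    using word_length_cls[of l g, OF l(2) lower that] upper[OF that] unfolding letters by simp_all
  obtain g where "g \<in> S" using False by auto
  then have "letter True \<noteq> letter False"
    \<comment> \<open>Every codeword begins with \<open>True\<close>.\<close>
    by (rule letter_neq[where u = "True # bit_code (c g)"]) (auto simp: w_def)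
  moreover have "equivalent_on S ?len l"
    unfolding equivalent_on_def
  proof (intro exI conjI ballI)
    show "0 < 1 / real (4 * N + 4)" "(0::real) < 1" by auto
    fix g assume "g \<in> S"
    note len = len[OF this]
    have "real (?len g) \<le> real (4 * N + 4) * real (l g)"
      using len(2) by (metis of_nat_le_iff of_nat_mult)
    then show "1 / real (4 * N + 4) * real (?len g) \<le> real (l g)"
      by (simp add: field_simps)
    show "real (l g) \<le> 1 * real (?len g)" using len(1) by simp
  qed
  ultimately show ?thesis
    using semigroup_cls generates_cls embedding_cls unfolding letters
    by (intro exI[of _ cls_carrier] exI[of _ cls_mult] exI[of _ "letter True"]
        exI[of _ "letter False"] exI[of _ "\<lambda>g. cls (w g)"]) simp
qed

lemma exists_isometric_extension:
  fixes S :: "'a set" and l :: "'a \<Rightarrow> nat"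
  assumes S: "semigroup_on S f" and D: "D_condition S f l"
  shows "\<exists>(K :: nat set) k C \<psi>.
        semigroup_on K k \<and> finite C \<and> generates K k C \<and>
        semigroup_embedding S f K k \<psi> \<and>
        (\<forall>g\<in>S. word_length k C (\<psi> g) = l g)"
proof -
  from D obtain a :: real where l: "\<And>x. x \<in> S \<Longrightarrow> 1 \<le> l x"
    "\<And>x y. x \<in> S \<Longrightarrow> y \<in> S \<Longrightarrow> l (f x y) \<le> l x + l y"
    and a: "0 < a" "\<And>r. 1 \<le> r \<Longrightarrow> finite {x \<in> S. l x \<le> r} \<and> real (card {x \<in> S. l x \<le> r}) \<le> a ^ r"
    unfolding D_condition_def by blast
  \<comment> \<open>With at least \<open>a\<close> letters the coding works for
    \<open>N = 1\<close>, so codewords have length exactly \<open>l g\<close>.\<close>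
  define A where "A = {..<nat \<lceil>a\<rceil>}"
  have A: "finite A" "a \<le> real (card A ^ 1)" using of_nat_ceiling[of a] by (simp_all add: A_def)
  obtain c :: "'a \<Rightarrow> nat list" where c: "inj_on c S" "\<And>x. x \<in> S \<Longrightarrow> set (c x) \<subseteq> A"
    "\<And>x. x \<in> S \<Longrightarrow> length (c x) = l x"
    using exists_coding[of S l a A 1, OF l(1) a A] by auto
  \<comment> \<open>An empty word would have no letter to carry the flags.\<close>
  have c_nonempty: "c g \<noteq> []" if "g \<in> S" for g using c(3) l(1) that by fastforce
  define w where "w g = flag_ends (c g)" for g
  interpret semigroup_on S f by (rule S)
  interpret coded_semigroup S f "A \<times> UNIV" w
  proof
    fix g assume g: "g \<in> S"
    then show "w g \<noteq> []" using c_nonempty[OF g] by (simp add: w_def flag_ends_def)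
    show "set (w g) \<subseteq> A \<times> UNIV" using c(2)[OF g] set_flag_ends by (simp add: w_def)
    fix h assume h: "h \<in> S"
    show "g = h" if "w g @ y = w h @ v" for y v
      using that flag_ends_prefix_free[OF _ c_nonempty[OF g] c_nonempty[OF h]] c(1) g h
      by (auto simp: w_def dest: inj_onD)
    show "x = [] \<or> length (w h) \<le> length x" if "x @ w g @ y = w h @ v" for x y v
      using that c_nonempty[OF g] unfolding w_def by (rule flag_ends_no_interior_start)
  qed
  have length_w: "length (w g) = l g" if "g \<in> S" for g using c(3)[OF that] by (simp add: w_def)
  have "word_length cls_mult (letter ` (A \<times> UNIV)) (cls (w g)) = l g" if "g \<in> S" for g
    using word_length_cls[of l g, OF l(2) _ that] length_w that by (simp add: le_antisym)
  moreover have "finite (letter ` (A \<times> UNIV))" using A(1) by simp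
  ultimately show ?thesis
    using semigroup_cls generates_cls embedding_cls
    by (intro exI[of _ cls_carrier] exI[of _ cls_mult] exI[of _ "letter ` (A \<times> UNIV)"]
        exI[of _ "\<lambda>g. cls (w g)"]) simp
qed

theorem theorem1p4:
  fixes S :: "'a set" and f :: "'a \<Rightarrow> 'a \<Rightarrow> 'a" and l :: "'a \<Rightarrow> nat"
  assumes "semigroup_on S f" and "D_condition S f l"
  shows
    "(\<exists>(H :: nat set) h b1 b2 \<phi>.
        semigroup_on H h \<and> b1 \<noteq> b2 \<and> generates H h {b1, b2} \<and>
        semigroup_embedding S f H h \<phi> \<and>
        equivalent_on S (\<lambda>g. word_length h {b1, b2} (\<phi> g)) l) \<and>
     (\<exists>(K :: nat set) k C \<psi>.
        semigroup_on K k \<and> finite C \<and> generates K k C \<and>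
        semigroup_embedding S f K k \<psi> \<and>
        (\<forall>g\<in>S. word_length k C (\<psi> g) = l g))"
  using exists_two_generated_extension[OF assms] exists_isometric_extension[OF assms] by blast

end
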